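(* Let $G$ be a finite simple graph such that $\operatorname{imb}_G(e)>0$ for every $e\in E(G)$, and suppose that $E(G)\neq\varnothing$. Let $\Delta=\max_{v\in V(G)}d_G(v)$. Then for every $A\subseteq E(G)$ with $|A|=k$, $$\sum_{e\in E(G)\setminus A}\min\{k,\operatorname{imb}_G(e)\}\ \ge\ k(\Delta-k)^{+}.$$
   Context: All graphs are finite, simple, and undirected. For a vertex $v$ of a graph $G$, $d_G(v)$ denotes its degree. The imbalance of an edge $uv\in E(G)$ is $\operatorname{imb}_G(uv)=|d_G(u)-d_G(v)|$. For an integer $q$, $q^{+}=\max\{q,0\}$. *)

theory Defs
  imports Main
begin

locale fin_simple_graph =
  fixes V :: "'a set" and E :: "'a set set"
  assumes finite_vertices: "finite V"
    and edges_wf: "e \<in> E \<Longrightarrow> e \<subseteq> V \<and> card e = 2"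

definition degree :: "'a set set \<Rightarrow> 'a \<Rightarrow> nat" where
  "degree E v = card {e \<in> E. v \<in> e}"

definition max_degree :: "'a set \<Rightarrow> 'a set set \<Rightarrow> nat" where
  "max_degree V E = Max (degree E ` V)"

text \<open>
  The value does not depend on which endpoint of the edge is called \<open>u\<close> and which \<open>v\<close>, so the
  definite description is well defined on every edge; see \<open>imb_edge\<close>. The degrees are subtracted
  as integers because subtraction on \<^typ>\<open>nat\<close> truncates.
\<close>
definition imb :: "'a set set \<Rightarrow> 'a set \<Rightarrow> int" where
  "imb E e = (THE d. \<exists>u v. e = {u, v} \<and> d = \<bar>int (degree E u) - int (degree E v)\<bar>)"

lemma imb_edge: "imb E {u, v} = \<bar>int (degree E u) - int (degree E v)\<bar>"
  unfolding imb_def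
  by (rule the_equality) (auto simp: doubleton_eq_iff abs_minus_commute)

definition pos_part :: "int \<Rightarrow> int" where
  "pos_part q = max q 0"

end

theory Submission
  imports Defs
begin

text \<open>
  If \<open>k \<ge> \<Delta>\<close> or \<open>k = 0\<close>, the right-hand side is 0. Otherwise let \<open>w\<close> be a vertex of degree \<open>\<Delta>\<close>
  and enlarge \<open>A \<inter> \<delta>(w)\<close> to a set \<open>C\<close> of exactly \<open>k\<close> of the \<open>\<Delta>\<close> edges at \<open>w\<close>. Each of the
  \<open>\<Delta> - k\<close> remaining edges \<open>wv\<close> is to be charged \<open>k\<close>. It contributes \<open>min k (\<Delta> - d(v))\<close> itself,
  and if this is less than \<open>k\<close>, then \<open>d(v) > \<Delta> - k\<close>: at most \<open>\<Delta> - k\<close> edges at \<open>v\<close> lead to \<open>w\<close> or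
  to one of the other \<open>\<Delta> - k - 1\<close> selected neighbours of \<open>w\<close>, and so at least
  \<open>d(v) - (\<Delta> - k)\<close> edges at \<open>v\<close> lead elsewhere. Those edges are not incident with \<open>w\<close>, belong to no
  other selected neighbour, and have imbalance at least 1, so that they supply what is missing
  (lemma \<open>star_and_exits_ge\<close>).

  Some of these supplementary edges may lie in \<open>A\<close>, but only \<open>\<bar>A - \<delta>(w)\<bar>\<close> of them. Because
  \<open>\<bar>A\<bar> = \<bar>C\<bar>\<close>, this is precisely the number of edges in \<open>C - A\<close>, and each of these, not having been
  charged so far, contributes at least 1. The two corrections cancel.
\<close>

definition star :: "'a set set \<Rightarrow> 'a \<Rightarrow> 'a set set" where
  "star E w = {e \<in> E. w \<in> e}"

text \<open>
  Subtracting pairs instead of testing for an endpoint outside \<open>X\<close> makes the bound on the number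
  of exits a bound on the cardinality of a difference.
\<close>
definition exits :: "'a set set \<Rightarrow> 'a set \<Rightarrow> 'a \<Rightarrow> 'a set set" where
  "exits E X v = star E v - (\<lambda>u. {v, u}) ` (X - {v})"

context fin_simple_graph
begin

lemma finite_edges: "finite E"
  using finite_vertices edges_wf
  by (meson Pow_iff finite_Pow_iff finite_subset subsetI)

lemma degree_le_max_degree: "v \<in> V \<Longrightarrow> degree E v \<le> max_degree V E"
  unfolding max_degree_def using finite_vertices by simp

lemma obtain_max_degree_vertex:
  assumes "E \<noteq> {}"
  obtains w where "w \<in> V" and "degree E w = max_degree V E"
proof -
  from assms obtain e where "e \<in> E" by blast
  then have "V \<noteq> {}" using edges_wf[of e] by auto
  then have "max_degree V E \<in> degree E ` V"
    unfolding max_degree_def using finite_vertices by (intro Max_in) auto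
  then show thesis using that by auto
qed

lemma star_edge:
  assumes "e \<in> star E w"
  obtains v where "e = {w, v}" and "v \<noteq> w" and "v \<in> V"
proof -
  from assms have "e \<subseteq> V" "card e = 2" "w \<in> e"
    using edges_wf by (auto simp: star_def)
  then show thesis using that by (auto simp: card_2_iff doubleton_eq_iff)
qed

lemma finite_star: "finite (star E w)"
  unfolding star_def using finite_edges by simp

lemma card_star: "card (star E w) = degree E w"
  by (simp add: star_def degree_def)

lemma card_exits_ge:
  assumes "finite X" and "v \<in> X"
  shows "int (card (exits E X v)) \<ge> int (degree E v) - (int (card X) - 1)"
proof -
  have "card (star E v) - card ((\<lambda>u. {v, u}) ` (X - {v})) \<le> card (exits E X v)"
    unfolding exits_def using assms(1) by (intro diff_card_le_card_Diff) simp
  moreover have "card ((\<lambda>u. {v, u}) ` (X - {v})) \<le> card X - 1"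
    using card_image_le[of "X - {v}" "\<lambda>u. {v, u}"] assms by simp
  moreover have "card X \<ge> 1"
    using assms by (metis One_nat_def Suc_leI card_gt_0_iff empty_iff)
  ultimately show ?thesis by (simp add: card_star)
qed

lemma exits_avoid:
  assumes "e \<in> exits E X v" and "u \<in> X" and "u \<noteq> v"
  shows "u \<notin> e"
proof
  assume "u \<in> e"
  from assms(1) obtain x where "e = {v, x}" by (auto simp: exits_def elim: star_edge)
  with \<open>u \<in> e\<close> \<open>u \<noteq> v\<close> have "e = {v, u}" by auto
  with assms show False by (auto simp: exits_def)
qed

lemma disjoint_exits:
  assumes "u \<in> X" and "v \<in> X" and "u \<noteq> v"
  shows "exits E X u \<inter> exits E X v = {}"
proof -
  have "u \<notin> e" if "e \<in> exits E X v" for e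
    using exits_avoid[OF that] assms by blast
  then show ?thesis by (auto simp: exits_def star_def)
qed

text \<open>
  The imbalance of \<open>wv\<close> falls short of \<open>k\<close> by \<open>d(v) - (d(w) - k)\<close>. As \<open>N\<close> has \<open>d(w) - k\<close>
  elements, that many edges at \<open>v\<close> are guaranteed to leave \<open>insert w N\<close>. So each \<open>v \<in> N\<close> accounts
  for at least \<open>k\<close>, and no edge is counted for two vertices of \<open>N\<close>.
\<close>
lemma star_and_exits_ge:
  assumes N: "finite N" "w \<notin> N" "card N + k = degree E w"
    and le: "\<And>v. v \<in> N \<Longrightarrow> degree E v \<le> degree E w"
  shows "int k * int (card N) \<le> (\<Sum>e\<in>(\<lambda>v. {w, v}) ` N. min (int k) (imb E e))
     + int (card (\<Union>v\<in>N. exits E (insert w N) v))"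
proof -
  let ?X = "insert w N"
  have pointwise: "int k \<le> min (int k) (imb E {w, v}) + int (card (exits E ?X v))"
    if "v \<in> N" for v
  proof -
    have "int (card (exits E ?X v)) \<ge> int (degree E v) - int (card N)"
      using card_exits_ge[of ?X v] N that by simp
    then show ?thesis
      using N(3) le[OF that] by (simp add: imb_edge)
  qed
  have "int k * int (card N)
      \<le> (\<Sum>v\<in>N. min (int k) (imb E {w, v}) + int (card (exits E ?X v)))"
    using sum_bounded_below[of N "int k", OF pointwise] by (simp add: mult.commute)
  also have "\<dots> = (\<Sum>v\<in>N. min (int k) (imb E {w, v})) + (\<Sum>v\<in>N. int (card (exits E ?X v)))"
    by (rule sum.distrib)
  also have "(\<Sum>v\<in>N. min (int k) (imb E {w, v}))
      = (\<Sum>e\<in>(\<lambda>v. {w, v}) ` N. min (int k) (imb E e))"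
    by (subst sum.reindex) (auto simp: inj_on_def doubleton_eq_iff)
  also have "(\<Sum>v\<in>N. int (card (exits E ?X v))) = int (card (\<Union>v\<in>N. exits E ?X v))"
    using N(1) finite_star disjoint_exits[of _ ?X]
    by (subst card_UN_disjoint) (auto simp: exits_def)
  finally show ?thesis .
qed

end

theorem lemma3p1:
  fixes V :: "'a set" and E A :: "'a set set" and k :: nat
  assumes "fin_simple_graph V E"
    and "\<forall>e\<in>E. imb E e > 0"
    and "E \<noteq> {}"
    and "A \<subseteq> E" and "card A = k"
  shows "(\<Sum>e\<in>E - A. min (int k) (imb E e)) \<ge> int k * pos_part (int (max_degree V E) - int k)"
proof -
  interpret fin_simple_graph V E by fact
  let ?g = "\<lambda>e. min (int k) (imb E e)"
  have g_nonneg: "?g e \<ge> 0" if "e \<in> E" for e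
    using assms(2) that by force
  show ?thesis
  proof (cases "0 < k \<and> k < max_degree V E")
    case False
    then have "int k * pos_part (int (max_degree V E) - int k) = 0"
      by (auto simp: pos_part_def)
    also have "0 \<le> (\<Sum>e\<in>E - A. ?g e)"
      using g_nonneg by (intro sum_nonneg) blast
    finally show ?thesis .
  next
    case True
    have g_pos: "?g e \<ge> 1" if "e \<in> E" for e
      using assms(2) that True by force
    have count: "int (card F) \<le> (\<Sum>e\<in>F. ?g e)" if "F \<subseteq> E" for F
      using sum_bounded_below[of F 1 ?g] g_pos that by auto
    have finA: "finite A"
      using assms(4) finite_edges by (rule finite_subset)
    obtain w where w: "w \<in> V" "degree E w = max_degree V E"
      using obtain_max_degree_vertex[OF assms(3)] by blast
    obtain C where C: "A \<inter> star E w \<subseteq> C" "C \<subseteq> star E w" "card C = k"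
    proof -
      have "card (A \<inter> star E w) \<le> k"
        using assms(5) finA by (metis card_mono inf_le1)
      moreover have "k \<le> card (star E w)"
        using True w by (simp add: card_star)
      ultimately show thesis
        using exists_subset_between[of "A \<inter> star E w" k "star E w"] finite_star that
        by auto
    qed
    have finC: "finite C"
      using C(2) finite_star by (rule finite_subset)
    define N where "N = {v. {w, v} \<in> star E w - C}"
    have N_image: "(\<lambda>v. {w, v}) ` N = star E w - C"
      unfolding N_def by (auto elim: star_edge)
    have inj: "inj_on (\<lambda>v. {w, v}) N"
      by (auto simp: inj_on_def doubleton_eq_iff)
    have N_V: "v \<in> V" "v \<noteq> w" if "v \<in> N" for v
      using that edges_wf[of "{w, v}"] by (auto simp: N_def star_def)
    have finN: "finite N"
      using N_V(1) finite_vertices by (meson finite_subset subsetI)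
    have "card N = card (star E w - C)"
      using card_image[OF inj] N_image by simp
    then have cardN: "card N + k = degree E w"
      using C finC True w by (simp add: card_Diff_subset card_star)
    define F where "F = (\<Union>v\<in>N. exits E (insert w N) v)"
    have F_E: "F \<subseteq> E"
      by (auto simp: F_def exits_def star_def)
    have F_star: "F \<inter> star E w = {}"
      using exits_avoid N_V(2) by (fastforce simp: F_def star_def)
    have finF: "finite F"
      using F_E finite_edges by (rule finite_subset)
    have charge: "int k * int (card N) \<le> (\<Sum>e\<in>star E w - C. ?g e) + int (card F)"
      using star_and_exits_ge[of N w k] finN N_V cardN degree_le_max_degree w
      by (auto simp: N_image F_def)
    \<comment> \<open>The edges leaving \<open>insert w N\<close> that are lost to \<open>A\<close> are compensated by those of \<open>C - A\<close>, since \<open>\<bar>A\<bar> = \<bar>C\<bar>\<close>.\<close>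
    have exchange: "card F \<le> card (C - A) + card (F - A)"
    proof -
      have "card F \<le> card (F \<inter> A) + card (F - A)"
        using card_Un_le[of "F \<inter> A" "F - A"] by (simp add: Int_Diff_Un)
      moreover have "card (F \<inter> A) \<le> card (A - C)"
        using F_star C(2) finA by (intro card_mono) auto
      moreover have "card (A - C) = card (C - A)"
        using card_Diff_subset_Int[of A C] card_Diff_subset_Int[of C A] finA finC
          C(3) assms(5) by (simp add: Int_commute)
      ultimately show ?thesis by linarith
    qed
    have "int k * pos_part (int (max_degree V E) - int k) = int k * int (card N)"
      using cardN w by (simp add: pos_part_def flip: cardN)
    also have "\<dots> \<le> (\<Sum>e\<in>star E w - C. ?g e) + int (card (C - A)) + int (card (F - A))"
      using charge exchange by linarith
    also have "\<dots> \<le> (\<Sum>e\<in>star E w - C. ?g e) + (\<Sum>e\<in>C - A. ?g e) + (\<Sum>e\<in>F - A. ?g e)"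
    proof -
      have "C - A \<subseteq> E" "F - A \<subseteq> E"
        using C(2) F_E by (auto simp: star_def)
      from this[THEN count] show ?thesis by linarith
    qed
    also have "\<dots> = (\<Sum>e\<in>(star E w - C) \<union> (C - A) \<union> (F - A). ?g e)"
      using finite_star finC finF F_star C(2)
      by (subst sum.union_disjoint, auto)+
    also have "\<dots> \<le> (\<Sum>e\<in>E - A. ?g e)"
      using finite_edges g_nonneg C(1,2) F_E
      by (intro sum_mono2) (auto simp: star_def)
    finally show ?thesis .
  qed
qed

end
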